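(* For any normalized monotone set function $f$ over $[m]$ and any integer $k>0$, the Batched Greedy Selection algorithm achieves a $\left(1-e^{-1/(\mathrm{SMW}(f)+1)}\right)$-approximation for the cardinality constrained maximization problem $\max\{f(S): S\subseteq[m], |S|\le k\}$, after making $O\left(m^{\mathrm{SMW}(f)+1}\right)$ value queries.
   Context: A set function $f:2^{[m]}\to\mathbb{R}$ is normalized if $f(\emptyset)=0$ and monotone if $f(S)\le f(T)$ whenever $S\subseteq T$; it is accessed through a value oracle returning $f(S)$ for queried $S$. Write $f(S\mid T)=f(S\cup T)-f(T)$, $f(v\mid T)=f(\{v\}\mid T)$. A set $T$ is supermodular w.r.t. $f$ if there exist $S\subseteq[m]$ and $v\in[m]\setminus T$ with $f(v\mid S\cup T)>\max_{T'\subsetneq T} f(v\mid S\cup T')$; $\mathrm{SMW}(f)$ is the maximum cardinality of a nonempty supermodular set (0 if none). Batched Greedy Selection: start with $S_0=\emptyset$; while $|S_{i-1}|<k$, let $s=\min\{\mathrm{SMW}(f)+1,\,k-|S_{i-1}|\}$, choose $T_i\subseteq[m]$ with $|T_i|\le s$ maximizing $f(T_i\mid S_{i-1})$, and set $S_i=S_{i-1}\cup T_i$; output the final $S_i$. An $\alpha$-approximation means the output has value at least $\alpha$ times the optimum.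
   Formalization: The O-constant may depend on k (uniformly in k the bound fails: f(S)=|S|, k=m); the loop also stops at S=[m] (needed for k>m); ties go by a fixed rule on the current set and its maximizers, and halting is proved only for rules preferring new elements, as with f=0 it may never stop. *)

theory Defs
  imports Complex_Main "HOL-Library.While_Combinator"
begin

definition marginal :: "(nat set \<Rightarrow> real) \<Rightarrow> nat set \<Rightarrow> nat set \<Rightarrow> real" where
  "marginal f S T = f (S \<union> T) - f T"

text \<open>The ground set \<open>[m]\<close> is \<^term>\<open>{1..m}\<close>; a set function on \<open>[m]\<close> is a function on
  \<^typ>\<open>nat set\<close> of which only the values on subsets of \<^term>\<open>{1..m}\<close> are ever used.
  Only nonempty \<open>T\<close> are meaningful below, since for \<open>T = {}\<close> the maximum ranges over the
  empty set.\<close>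

definition supermodular_set :: "nat \<Rightarrow> (nat set \<Rightarrow> real) \<Rightarrow> nat set \<Rightarrow> bool" where
  "supermodular_set m f T \<longleftrightarrow> T \<subseteq> {1..m} \<and>
     (\<exists>S v. S \<subseteq> {1..m} \<and> v \<in> {1..m} - T \<and>
        marginal f {v} (S \<union> T) > Max ((\<lambda>T'. marginal f {v} (S \<union> T')) ` {T'. T' \<subset> T}))"

definition SMW :: "nat \<Rightarrow> (nat set \<Rightarrow> real) \<Rightarrow> nat" where
  "SMW m f = (if \<exists>T. T \<noteq> {} \<and> supermodular_set m f T
              then Max (card ` {T. T \<noteq> {} \<and> supermodular_set m f T}) else 0)"

text \<open>Computations with access to a value oracle: the program sees the set function only
  through the answers to its queries.\<close>

datatype 'a oracle_prog = Return 'a | Query "nat set" "real \<Rightarrow> 'a oracle_prog"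

primrec result :: "(nat set \<Rightarrow> real) \<Rightarrow> 'a oracle_prog \<Rightarrow> 'a" where
  "result f (Return a) = a"
| "result f (Query A c) = result f (c (f A))"

primrec queries :: "(nat set \<Rightarrow> real) \<Rightarrow> 'a oracle_prog \<Rightarrow> nat" where
  "queries f (Return a) = 0"
| "queries f (Query A c) = Suc (queries f (c (f A)))"

primrec query_all :: "nat set list \<Rightarrow> (real list \<Rightarrow> 'a oracle_prog) \<Rightarrow> 'a oracle_prog" where
  "query_all [] c = c []"
| "query_all (A # As) c = Query A (\<lambda>x. query_all As (\<lambda>xs. c (x # xs)))"

text \<open>A while loop whose body is an oracle program. It yields the final state together with
  the total number of queries, and \<^term>\<open>None\<close> if the loop does not terminate.\<close>

definition oracle_while ::
  "('s \<Rightarrow> bool) \<Rightarrow> ('s \<Rightarrow> 's oracle_prog) \<Rightarrow> (nat set \<Rightarrow> real) \<Rightarrow> 's \<Rightarrow> ('s \<times> nat) option" where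
  "oracle_while b c f s =
     while_option (\<lambda>(s, n). b s) (\<lambda>(s, n). (result f (c s), n + queries f (c s))) (s, 0)"

text \<open>All subsets of \<open>[m]\<close> with at most \<open>s\<close> elements, each listed exactly once.\<close>

definition batches :: "nat \<Rightarrow> nat \<Rightarrow> nat set list" where
  "batches m s = map set (filter (\<lambda>xs. length xs \<le> s) (subseqs [1..<Suc m]))"

text \<open>One round, from the current set \<open>S\<close>: by exhaustive search, compute the set \<open>M\<close> of all
  batches \<open>T\<close> of size at most \<open>s\<close> that maximize \<open>f(T | S)\<close>, and add the one chosen by the
  tie-breaking rule \<open>sel\<close>.\<close>

definition greedy_round ::
  "nat \<Rightarrow> nat \<Rightarrow> (nat set \<Rightarrow> nat set set \<Rightarrow> nat set) \<Rightarrow> nat set \<Rightarrow> nat set oracle_prog" where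
  "greedy_round m s sel S =
     Query S (\<lambda>b. query_all (map (\<lambda>T. T \<union> S) (batches m s)) (\<lambda>xs.
       let gains = set (zip (batches m s) (map (\<lambda>x. x - b) xs));
           M = {T. \<exists>g. (T, g) \<in> gains \<and> (\<forall>(T', g') \<in> gains. g' \<le> g)}
       in Return (S \<union> sel S M)))"

text \<open>The condition \<^term>\<open>S \<noteq> {1..m}\<close> is relevant only for \<open>k > m\<close>, where \<open>|S| < k\<close> alone
  would never become false.\<close>

definition batched_greedy ::
  "nat \<Rightarrow> (nat set \<Rightarrow> real) \<Rightarrow> nat \<Rightarrow> (nat set \<Rightarrow> nat set set \<Rightarrow> nat set) \<Rightarrow> (nat set \<times> nat) option"
where
  "batched_greedy m f k sel =
     oracle_while (\<lambda>S. card S < k \<and> S \<noteq> {1..m})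
       (\<lambda>S. greedy_round m (min (SMW m f + 1) (k - card S)) sel S) f {}"

definition selection_rule :: "(nat set \<Rightarrow> nat set set \<Rightarrow> nat set) \<Rightarrow> bool" where
  "selection_rule sel \<longleftrightarrow> (\<forall>S M. M \<noteq> {} \<longrightarrow> sel S M \<in> M)"

text \<open>Ties are broken in favour of batches that contribute a new element. Without this a rule
  may return a batch contained in \<open>S\<close> (e.g. the empty one when \<open>f = 0\<close>) in every round, and
  the loop runs forever.\<close>

definition prefers_new :: "(nat set \<Rightarrow> nat set set \<Rightarrow> nat set) \<Rightarrow> bool" where
  "prefers_new sel \<longleftrightarrow> (\<forall>S M. (\<exists>T\<in>M. \<not> T \<subseteq> S) \<longrightarrow> \<not> sel S M \<subseteq> S)"

definition approx_solution :: "nat \<Rightarrow> (nat set \<Rightarrow> real) \<Rightarrow> nat \<Rightarrow> real \<Rightarrow> nat set \<Rightarrow> bool" where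
  "approx_solution m f k \<alpha> S \<longleftrightarrow> S \<subseteq> {1..m} \<and> card S \<le> k \<and>
     f S \<ge> \<alpha> * Max (f ` {S'. S' \<subseteq> {1..m} \<and> card S' \<le> k})"

end

theory Submission imports Defs begin

text \<open>Write \<open>d\<close> for the supermodular width, \<open>O\<close> for an optimal set and \<open>g\<close> for the gain of a
  round with full budget \<open>d + 1\<close> started at \<open>S\<close>. A marginal value \<open>f(v | S \<union> T)\<close> does not
  decrease when \<open>T\<close> is replaced by a suitable subset with at most \<open>d\<close> elements, so it is at
  most \<open>g\<close>. Adding the elements of \<open>O\<close> one by one, the first \<open>d + 1\<close> of them together also gain
  at most \<open>g\<close>; hence \<open>f(O | S) \<le> (k - d) g\<close>, and a full round shrinks \<open>f(O) - f(S)\<close> by the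
  factor \<open>1 - 1/(k - d) \<le> exp(-1/(k - d))\<close>. Rounds are full as long as \<open>|S| < k - d\<close> and each
  adds at most \<open>d + 1\<close> elements, so once \<open>|S| \<ge> k - d\<close> the deficit is at most
  \<open>exp(-1/(d + 1)) f(O)\<close>: the truncated rounds at the end need not gain anything. (Using
  \<open>f(O | S) \<le> k g\<close> instead would lose the guarantee when \<open>d + 1\<close> does not divide \<open>k\<close>.) If
  \<open>k \<le> d\<close>, the first round already finds an optimal set.\<close>

section \<open>Supermodular width\<close>

lemma card_le_SMW:
  assumes "T \<noteq> {}" "supermodular_set m f T"
  shows "card T \<le> SMW m f"
proof -
  have "finite {T. T \<noteq> {} \<and> supermodular_set m f T}"
    by (rule finite_subset[of _ "Pow {1..m}"]) (auto simp: supermodular_set_def)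
  then have "card T \<le> Max (card ` {T. T \<noteq> {} \<and> supermodular_set m f T})"
    using assms by (intro Max_ge) auto
  then show ?thesis
    using assms by (auto simp: SMW_def)
qed

text \<open>Above the width a set is not supermodular, so the maximum over its proper subsets
  dominates; by finiteness this maximum is attained.\<close>

lemma marginal_le_proper_subset:
  assumes "T \<subseteq> {1..m}" "S \<subseteq> {1..m}" "v \<in> {1..m} - T" "SMW m f < card T"
  obtains T' where "T' \<subset> T" "marginal f {v} (S \<union> T) \<le> marginal f {v} (S \<union> T')"
proof -
  let ?G = "(\<lambda>T'. marginal f {v} (S \<union> T')) ` {T'. T' \<subset> T}"
  \<comment> \<open>Nonemptiness makes \<open>card_le_SMW\<close> applicable and keeps
    \<open>Max\<close> away from an empty family.\<close>
  have "T \<noteq> {}" using assms by auto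
  then have "\<not> supermodular_set m f T"
    using card_le_SMW[of T m f] assms by auto
  then have le: "marginal f {v} (S \<union> T) \<le> Max ?G"
    using assms by (auto simp: supermodular_set_def not_less)
  have "finite T" using assms finite_subset by blast
  then have "finite {T'. T' \<subset> T}"
    by (intro finite_subset[of "{T'. T' \<subset> T}" "Pow T"]) auto
  then have "finite ?G" by (rule finite_imageI)
  moreover have "?G \<noteq> {}" using \<open>T \<noteq> {}\<close> by blast
  ultimately have "Max ?G \<in> ?G" by (rule Max_in)
  then obtain T' where "T' \<subset> T" "Max ?G = marginal f {v} (S \<union> T')" by blast
  then show thesis using that le by metis
qed

text \<open>Descent: while the cardinality exceeds the width, pass to a proper subset at no loss of
  marginal value.\<close>

lemma marginal_le_small_subset:
  assumes "T \<subseteq> {1..m}" "S \<subseteq> {1..m}" "v \<in> {1..m} - T"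
  shows "\<exists>T'\<subseteq>T. card T' \<le> SMW m f \<and> marginal f {v} (S \<union> T) \<le> marginal f {v} (S \<union> T')"
  using assms
proof (induction "card T" arbitrary: T rule: less_induct)
  case less
  show ?case
  proof (cases "card T \<le> SMW m f")
    case True
    then show ?thesis by blast
  next
    case False
    obtain U where U: "U \<subset> T" "marginal f {v} (S \<union> T) \<le> marginal f {v} (S \<union> U)"
      using marginal_le_proper_subset[OF less.prems] False by (metis not_le)
    have "finite T" using less.prems finite_subset by blast
    then have "card U < card T" using U by (simp add: psubset_card_mono)
    with less.hyps[of U] less.prems U obtain T' where
      "T' \<subseteq> U" "card T' \<le> SMW m f" "marginal f {v} (S \<union> U) \<le> marginal f {v} (S \<union> T')"
      by blast
    then show ?thesis using U by (metis order.trans psubset_imp_subset)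
  qed
qed

text \<open>The truncated subtraction covers the sets that fit into a single batch.\<close>

lemma marginal_le_batches:
  assumes mono: "mono_on (Pow {1..m}) f" and S: "S \<subseteq> {1..m}"
    and g: "\<And>T. T \<subseteq> {1..m} \<Longrightarrow> card T \<le> SMW m f + 1 \<Longrightarrow> marginal f T S \<le> g"
    and A: "A \<subseteq> {1..m}"
  shows "marginal f A S \<le> (1 + real (card A - (SMW m f + 1))) * g"
proof -
  have "finite A" using A finite_subset by blast
  then show ?thesis using A
  proof (induction A rule: finite_induct)
    case empty
    then show ?case using g[of "{}"] by simp
  next
    case (insert v A)
    show ?case
    proof (cases "card (insert v A) \<le> SMW m f + 1")
      case True
      then show ?thesis using g[of "insert v A"] insert.prems by simp
    next
      case False
      obtain T' where T': "T' \<subseteq> A" "card T' \<le> SMW m f"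
        "marginal f {v} (S \<union> A) \<le> marginal f {v} (S \<union> T')"
        using marginal_le_small_subset[of A m S v f] insert S by auto
      have "finite T'" "v \<notin> T'" using T' insert finite_subset by blast+
      then have "card (insert v T') \<le> SMW m f + 1" using T' by simp
      then have "marginal f (insert v T') S \<le> g"
        using g[of "insert v T'"] T' insert.prems by blast
      \<comment> \<open>The gain of \<open>insert v T'\<close> over \<open>S\<close> exceeds that of
        \<open>v\<close> over \<open>S \<union> T'\<close> by
        \<open>f (S \<union> T') - f S\<close>, which must be nonnegative.\<close>
      moreover have "f S \<le> f (S \<union> T')"
        using S T' insert.prems by (intro mono_onD[OF mono]) auto
      ultimately have "marginal f {v} (S \<union> A) \<le> g"
        using T'(3) by (simp add: marginal_def Un_commute)
      moreover have "marginal f (insert v A) S = marginal f {v} (S \<union> A) + marginal f A S"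
        by (simp add: marginal_def Un_commute)
      \<comment> \<open>Here \<open>card A\<close> is at least \<open>SMW m f + 1\<close>, so
        neither subtraction is truncated.\<close>
      moreover have "real (card (insert v A) - (SMW m f + 1)) = real (card A - (SMW m f + 1)) + 1"
        using False insert by simp
      ultimately show ?thesis
        using insert by (simp add: algebra_simps)
    qed
  qed
qed

section \<open>One round\<close>

lemma result_query_all [simp]: "result f (query_all As c) = result f (c (map f As))"
  by (induction As arbitrary: c) auto

lemma queries_query_all [simp]:
  "queries f (query_all As c) = length As + queries f (c (map f As))"
  by (induction As arbitrary: c) auto

lemma set_batches: "set (batches m s) = {T. T \<subseteq> {1..m} \<and> card T \<le> s}"
proof (intro equalityI subsetI)
  fix T assume "T \<in> set (batches m s)"
  then obtain xs where xs: "T = set xs" "xs \<in> set (subseqs [1..<Suc m])" "length xs \<le> s"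
    by (auto simp: batches_def simp del: upt_Suc)
  have "set xs \<in> set ` set (subseqs [1..<Suc m])" using xs by blast
  then have "set xs \<subseteq> {1..m}" unfolding subseqs_powset by auto
  moreover have "card (set xs) \<le> s" using xs card_length order.trans by blast
  ultimately show "T \<in> {T. T \<subseteq> {1..m} \<and> card T \<le> s}" using xs by blast
next
  fix T assume T: "T \<in> {T. T \<subseteq> {1..m} \<and> card T \<le> s}"
  then have "T \<in> set ` set (subseqs [1..<Suc m])" unfolding subseqs_powset by auto
  then obtain xs where xs: "T = set xs" "xs \<in> set (subseqs [1..<Suc m])" by blast
  then have "distinct xs" using subseqs_distinctD distinct_upt by blast
  then have "length xs \<le> s" using xs T distinct_card by fastforce
  then show "T \<in> set (batches m s)" using xs by (auto simp: batches_def simp del: upt_Suc)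
qed

text \<open>Splitting the subsequences of \<open>x # xs\<close> by whether they keep
  \<open>x\<close> gives Pascal's recurrence, from which the power bound follows by
  induction.\<close>

lemma length_short_subseqs:
  "length (filter (\<lambda>ys. length ys \<le> s) (subseqs xs)) \<le> (length xs + 1) ^ s"
proof (induction xs arbitrary: s)
  case Nil
  then show ?case by simp
next
  case (Cons x xs)
  show ?case
  proof (cases s)
    case 0
    then show ?thesis using Cons[of 0]
      by (simp add: Let_def filter_map o_def)
  next
    case (Suc t)
    have "length (filter (\<lambda>ys. length ys \<le> s) (subseqs (x # xs)))
        = length (filter (\<lambda>ys. length ys \<le> t) (subseqs xs))
          + length (filter (\<lambda>ys. length ys \<le> s) (subseqs xs))"
      using Suc by (simp add: Let_def filter_map o_def)
    also have "\<dots> \<le> (length xs + 1) ^ t + (length xs + 1) ^ s"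
      using Cons add_mono by blast
    also have "\<dots> = (length xs + 2) * (length xs + 1) ^ t" using Suc by simp
    also have "\<dots> \<le> (length xs + 2) * (length xs + 2) ^ t"
      by (intro mult_left_mono power_mono) auto
    finally show ?thesis using Suc by simp
  qed
qed

lemma length_batches: "length (batches m s) \<le> (m + 1) ^ s"
  using length_short_subseqs[of s "[1..<Suc m]"] by (simp add: batches_def del: upt_Suc)

text \<open>Declarative form of the set \<open>M\<close> that \<open>greedy_round\<close> computes
  from the list of oracle answers.\<close>

definition best_batches :: "nat \<Rightarrow> (nat set \<Rightarrow> real) \<Rightarrow> nat \<Rightarrow> nat set \<Rightarrow> nat set set" where
  "best_batches m f s S = {T. T \<subseteq> {1..m} \<and> card T \<le> s \<and>
     (\<forall>T'. T' \<subseteq> {1..m} \<longrightarrow> card T' \<le> s \<longrightarrow> marginal f T' S \<le> marginal f T S)}"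

lemma result_greedy_round:
  "result f (greedy_round m s sel S) = S \<union> sel S (best_batches m f s S)"
proof -
  have "set (zip (batches m s) (map (\<lambda>x. x - f S) (map f (map (\<lambda>T. T \<union> S) (batches m s)))))
      = (\<lambda>T. (T, marginal f T S)) ` {T. T \<subseteq> {1..m} \<and> card T \<le> s}"
    unfolding set_batches[symmetric]
    by (simp add: zip_map2 zip_same_conv_map image_image marginal_def del: set_map)
      (simp add: image_image)
  moreover have "{T. \<exists>g. (T, g) \<in> (\<lambda>T. (T, marginal f T S)) ` {T. T \<subseteq> {1..m} \<and> card T \<le> s} \<and>
        (\<forall>(T', g') \<in> (\<lambda>T. (T, marginal f T S)) ` {T. T \<subseteq> {1..m} \<and> card T \<le> s}. g' \<le> g)}
      = best_batches m f s S"
    by (auto simp: best_batches_def)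
  ultimately show ?thesis
    by (simp add: greedy_round_def Let_def del: map_map)
qed

lemma queries_greedy_round:
  "queries f (greedy_round m s sel S) = Suc (length (batches m s))"
  by (simp add: greedy_round_def Let_def)

text \<open>From \<open>m + 1 \<le> 2 * m\<close> the excess becomes a factor
  \<open>2 ^ s \<le> 2 ^ k\<close>, free of \<open>m\<close>; the summand \<open>1\<close> pays for
  querying \<open>S\<close> itself.\<close>

lemma queries_greedy_round_le:
  assumes "m > 0" "s \<le> k" "s \<le> e"
  shows "queries f (greedy_round m s sel S) \<le> (2 ^ k + 1) * m ^ e"
proof -
  have "(m + 1) ^ s \<le> (2 * m) ^ s" using assms by (intro power_mono) auto
  also have "\<dots> = 2 ^ s * m ^ s" by (rule power_mult_distrib)
  also have "\<dots> \<le> 2 ^ k * m ^ e"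
    using assms by (intro mult_mono power_increasing) auto
  finally have "length (batches m s) \<le> 2 ^ k * m ^ e"
    using length_batches order.trans by blast
  moreover have "1 \<le> m ^ e" using assms by simp
  ultimately show ?thesis by (simp add: queries_greedy_round)
qed

lemma best_batches_nonempty: "best_batches m f s S \<noteq> {}"
proof -
  let ?B = "{T. T \<subseteq> {1..m} \<and> card T \<le> s}"
  have "finite ?B" by (rule finite_subset[of _ "Pow {1..m}"]) auto
  moreover have "{} \<in> ?B" by simp
  then have "?B \<noteq> {}" by blast
  ultimately have "Max ((\<lambda>T. marginal f T S) ` ?B) \<in> (\<lambda>T. marginal f T S) ` ?B"
    by (intro Max_in finite_imageI) (simp_all only: image_is_empty not_False_eq_True)
  then obtain T where "T \<in> ?B" "marginal f T S = Max ((\<lambda>T. marginal f T S) ` ?B)"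
    by auto
  then have "T \<in> best_batches m f s S"
    using \<open>finite ?B\<close> by (auto simp: best_batches_def)
  then show ?thesis by blast
qed

lemma sel_in_best_batches:
  "selection_rule sel \<Longrightarrow> sel S (best_batches m f s S) \<in> best_batches m f s S"
  using best_batches_nonempty by (simp add: selection_rule_def)

text \<open>If all maximizers lay inside \<open>S\<close>, the best gain would be 0; by monotonicity
  any new singleton gains at least that and is a maximizer too.\<close>

lemma best_batches_new:
  assumes mono: "mono_on (Pow {1..m}) f" and S: "S \<subset> {1..m}" and s: "s > 0"
  shows "\<exists>T\<in>best_batches m f s S. \<not> T \<subseteq> S"
proof (rule ccontr)
  assume *: "\<not> ?thesis"
  obtain T where T: "T \<in> best_batches m f s S" using best_batches_nonempty by blast
  then have "T \<union> S = S" using * by blast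
  then have "marginal f T S = 0" by (simp add: marginal_def)
  obtain v where v: "v \<in> {1..m}" "v \<notin> S" using S by blast
  have "f S \<le> f ({v} \<union> S)" using S v by (intro mono_onD[OF mono]) auto
  then have "marginal f T S \<le> marginal f {v} S"
    using \<open>marginal f T S = 0\<close> by (simp add: marginal_def)
  then have "{v} \<in> best_batches m f s S"
    using T v s by (auto simp: best_batches_def intro: order.trans[of _ "marginal f T S"])
  then show False using * v by blast
qed

section \<open>The loop\<close>

locale batched_greedy_run =
  fixes m k :: nat and f :: "nat set \<Rightarrow> real" and sel :: "nat set \<Rightarrow> nat set set \<Rightarrow> nat set"
  assumes normalized: "f {} = 0"
    and mono: "mono_on (Pow {1..m}) f"
    and sel: "selection_rule sel"
begin

abbreviation "d \<equiv> SMW m f"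

abbreviation "budget S \<equiv> min (d + 1) (k - card S)"

definition "batch S = sel S (best_batches m f (budget S) S)"

abbreviation "running S \<equiv> card S < k \<and> S \<noteq> {1..m}"

lemma f_mono: "A \<subseteq> B \<Longrightarrow> B \<subseteq> {1..m} \<Longrightarrow> f A \<le> f B"
  by (rule mono_onD[OF mono]) auto

lemma batched_greedy_eq:
  "batched_greedy m f k sel = while_option (\<lambda>(S, n). running S)
     (\<lambda>(S, n). (S \<union> batch S, n + queries f (greedy_round m (budget S) sel S))) ({}, 0)"
  by (simp add: batched_greedy_def oracle_while_def result_greedy_round batch_def)

lemma batched_greedy_invariant:
  assumes "batched_greedy m f k sel = Some (S, n)"
    and "P {} 0"
    and "\<And>S n. P S n \<Longrightarrow> running S \<Longrightarrow>
           P (S \<union> batch S) (n + queries f (greedy_round m (budget S) sel S))"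
  shows "P S n"
proof -
  have "(\<lambda>(S, n). P S n) (S, n)"
    by (rule while_option_rule[OF _ assms(1)[unfolded batched_greedy_eq]])
      (use assms in auto)
  then show ?thesis by simp
qed

lemma batch_subset: "batch S \<subseteq> {1..m}"
  and card_batch: "card (batch S) \<le> budget S"
  and batch_best: "T \<subseteq> {1..m} \<Longrightarrow> card T \<le> budget S \<Longrightarrow> marginal f T S \<le> marginal f (batch S) S"
proof -
  have "batch S \<in> best_batches m f (budget S) S"
    unfolding batch_def by (rule sel_in_best_batches[OF sel])
  then show "batch S \<subseteq> {1..m}" "card (batch S) \<le> budget S"
    "T \<subseteq> {1..m} \<Longrightarrow> card T \<le> budget S \<Longrightarrow> marginal f T S \<le> marginal f (batch S) S"
    unfolding best_batches_def by blast+
qed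

lemma card_Un_batch: "card (S \<union> batch S) \<le> card S + budget S"
  using card_Un_le[of S "batch S"] card_batch[of S] by linarith

lemma feasible:
  assumes "batched_greedy m f k sel = Some (S, n)"
  shows "S \<subseteq> {1..m} \<and> card S \<le> k"
proof (rule batched_greedy_invariant[OF assms])
  fix S :: "nat set" assume "S \<subseteq> {1..m} \<and> card S \<le> k" "running S"
  then show "S \<union> batch S \<subseteq> {1..m} \<and> card (S \<union> batch S) \<le> k"
    using batch_subset card_Un_batch[of S] by auto
qed auto

lemma stopped:
  assumes "batched_greedy m f k sel = Some (S, n)"
  shows "card S \<ge> k \<or> S = {1..m}"
  using while_option_stop[OF assms[unfolded batched_greedy_eq]] by auto

text \<open>A round that adds nothing would be repeated forever, so in a terminating run each round
  increases the cardinality. The second disjunct of the invariant is the state of being stuck.\<close>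

lemma query_bound:
  assumes run: "batched_greedy m f k sel = Some (S, n)"
  shows "n \<le> k * ((2 ^ k + 1) * m ^ (d + 1))"
proof -
  let ?Q = "(2 ^ k + 1) * m ^ (d + 1)"
  have "S \<subseteq> {1..m} \<and> (n \<le> card S * ?Q \<or> running S \<and> S \<union> batch S = S)"
  proof (rule batched_greedy_invariant[OF run])
    fix S n
    assume inv: "S \<subseteq> {1..m} \<and> (n \<le> card S * ?Q \<or> running S \<and> S \<union> batch S = S)"
      and "running S"
    let ?q = "queries f (greedy_round m (budget S) sel S)"
    have "n + ?q \<le> card (S \<union> batch S) * ?Q" if "S \<union> batch S \<noteq> S"
    proof -
      \<comment> \<open>For \<open>m = 0\<close> the set \<open>S\<close> would already be the whole
        ground set.\<close>
      have "m > 0" using \<open>running S\<close> inv by (cases m) auto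
      then have "?q \<le> ?Q" by (intro queries_greedy_round_le) auto
      moreover have "n \<le> card S * ?Q" using inv that by blast
      moreover have "finite (S \<union> batch S)"
        using inv batch_subset[of S] finite_subset[of _ "{1..m}"] by blast
      then have "card S < card (S \<union> batch S)"
        using that by (intro psubset_card_mono) auto
      then have "Suc (card S) \<le> card (S \<union> batch S)" by simp
      then have "Suc (card S) * ?Q \<le> card (S \<union> batch S) * ?Q" by (rule mult_le_mono1)
      ultimately show ?thesis by simp
    qed
    \<comment> \<open>A stuck round leaves the set, hence the next batch, unchanged; the state stays
      stuck whatever the counter.\<close>
    then show "S \<union> batch S \<subseteq> {1..m} \<and> (n + ?q \<le> card (S \<union> batch S) * ?Q
        \<or> running (S \<union> batch S) \<and> (S \<union> batch S) \<union> batch (S \<union> batch S) = S \<union> batch S)"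
      using inv batch_subset[of S] \<open>running S\<close> by (cases "S \<union> batch S = S") auto
  qed auto
  \<comment> \<open>On exit \<open>running S\<close> is false, which excludes the stuck
    disjunct.\<close>
  then have "n \<le> card S * ?Q" using stopped[OF run] by auto
  also have "\<dots> \<le> k * ?Q" using feasible[OF run] by (intro mult_le_mono1) auto
  finally show ?thesis .
qed

text \<open>Each round contributes a new element, so \<open>m - card S\<close> is a decreasing
  measure.\<close>

lemma terminates:
  assumes "prefers_new sel"
  shows "\<exists>S n. batched_greedy m f k sel = Some (S, n)"
proof -
  have step: "S \<union> batch S \<subseteq> {1..m} \<and> m - card (S \<union> batch S) < m - card S"
    if S: "S \<subseteq> {1..m}" "running S" for S
  proof -
    have "\<not> batch S \<subseteq> S"
      using assms best_batches_new[OF mono, of S "budget S"] S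
      unfolding prefers_new_def batch_def by auto
    then have "S \<subset> S \<union> batch S" by blast
    moreover have sub: "S \<union> batch S \<subseteq> {1..m}" using S batch_subset by blast
    ultimately have "card S < card (S \<union> batch S)" "card (S \<union> batch S) \<le> m"
      using psubset_card_mono[of "S \<union> batch S" S] card_mono[of "{1..m}" "S \<union> batch S"]
        finite_subset[of _ "{1..m}"] by auto
    then show ?thesis using sub by simp
  qed
  have "\<exists>t. batched_greedy m f k sel = Some t"
    unfolding batched_greedy_eq
    by (rule measure_while_option_Some[where P = "\<lambda>(S, n). S \<subseteq> {1..m}"
          and f = "\<lambda>(S, n). m - card S"]) (use step in \<open>auto simp only: split: prod.splits\<close>)
  then show ?thesis by auto
qed

section \<open>Approximation guarantee\<close>

lemma full_round_gain:
  assumes S: "S \<subseteq> {1..m}" and full: "card S + (d + 1) \<le> k"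
    and A: "A \<subseteq> {1..m}" "card A \<le> k"
  shows "f A - f S \<le> (real k - real d) * (f (S \<union> batch S) - f S)"
proof -
  let ?g = "marginal f (batch S) S"
  have g0: "0 \<le> ?g"
    using batch_best[of "{}" S] by (simp add: marginal_def)
  have "budget S = d + 1" using full by simp
  then have "marginal f A S \<le> (1 + real (card A - (d + 1))) * ?g"
    using batch_best[of _ S] by (intro marginal_le_batches[OF mono S _ A(1)]) auto
  \<comment> \<open>Fullness gives \<open>d + 1 \<le> k\<close>, so the truncated difference is at
    most \<open>k - d - 1\<close>.\<close>
  also have "\<dots> \<le> (real k - real d) * ?g"
    using A(2) full g0 by (intro mult_right_mono) auto
  finally have "marginal f A S \<le> (real k - real d) * ?g" .
  moreover have "f A \<le> f (A \<union> S)" using A S by (intro f_mono) auto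
  ultimately show ?thesis by (simp add: marginal_def Un_commute)
qed

text \<open>The exponent charges \<open>1 / ((d + 1) * (k - d))\<close> per element, so the at most
  \<open>d + 1\<close> elements of a full round cost no more than its factor
  \<open>exp (- 1 / (k - d))\<close> pays. The \<open>min\<close> freezes the bound once rounds may
  be truncated.\<close>

lemma deficit:
  assumes run: "batched_greedy m f k sel = Some (S, n)"
    and A: "A \<subseteq> {1..m}" "card A \<le> k" and d: "d < k"
  shows "f A - f S \<le> exp (- min (card S) (real k - d) / ((real d + 1) * (real k - d))) * f A"
proof -
  define a where "a = real k - real d"
  \<comment> \<open>Keeps the factor \<open>1 - 1 / a\<close> nonnegative, so the invariant can be
    multiplied by it.\<close>
  have a: "a \<ge> 1" using d by (simp add: a_def)
  have fA: "f A \<ge> 0" using f_mono[of "{}" A] A normalized by simp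
  have "S \<subseteq> {1..m} \<and> f A - f S \<le> exp (- min (card S) a / ((real d + 1) * a)) * f A"
  proof (rule batched_greedy_invariant[OF run])
    fix S
    assume inv: "S \<subseteq> {1..m} \<and> f A - f S \<le> exp (- min (card S) a / ((real d + 1) * a)) * f A"
    let ?S' = "S \<union> batch S"
    have sub: "?S' \<subseteq> {1..m}" using inv batch_subset by blast
    have "f A - f ?S' \<le> exp (- min (card ?S') a / ((real d + 1) * a)) * f A"
    proof (cases "real (card S) < a")
      case True
      then have full: "card S + (d + 1) \<le> k" using d by (simp add: a_def)
      have "f A - f S \<le> a * (f ?S' - f S)"
        unfolding a_def using full_round_gain[of S A] inv full A by simp
      then have "f A - f ?S' \<le> (1 - 1 / a) * (f A - f S)"
        using a by (simp add: field_simps)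
      also have "\<dots> \<le> (1 - 1 / a) * (exp (- real (card S) / ((real d + 1) * a)) * f A)"
        using inv True a by (intro mult_left_mono) auto
      also have "\<dots> \<le> exp (- 1 / a) * (exp (- real (card S) / ((real d + 1) * a)) * f A)"
        using exp_ge_add_one_self[of "- 1 / a"] fA by (intro mult_right_mono) auto
      also have "\<dots> = exp (- (real (card S) + (real d + 1)) / ((real d + 1) * a)) * f A"
      proof -
        have "- 1 / a + - real (card S) / ((real d + 1) * a)
            = - (real (card S) + (real d + 1)) / ((real d + 1) * a)"
          using a by (simp add: divide_simps)
        then show ?thesis by (simp add: exp_add[symmetric] mult.assoc[symmetric])
      qed
      also have "\<dots> \<le> exp (- min (card ?S') a / ((real d + 1) * a)) * f A"
      proof -
        have "card ?S' \<le> card S + (d + 1)" using card_Un_batch[of S] by simp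
        then have "min (card ?S') a \<le> real (card S) + (real d + 1)" by linarith
        then have "- (real (card S) + (real d + 1)) / ((real d + 1) * a)
            \<le> - min (card ?S') a / ((real d + 1) * a)"
          using a by (intro divide_right_mono) auto
        then show ?thesis using fA by (intro mult_right_mono) (simp_all only: exp_le_cancel_iff)
      qed
      finally show ?thesis .
    next
      case False
      have "finite ?S'" using sub finite_subset by blast
      then have "card S \<le> card ?S'" by (intro card_mono) auto
      \<comment> \<open>Both minima equal \<open>a\<close>, so monotonicity of \<open>f\<close>
        alone preserves the bound.\<close>
      then have "min (card ?S') a = min (card S) a" using False by simp
      moreover have "f S \<le> f ?S'" using sub by (intro f_mono) auto
      ultimately show ?thesis using inv by simp
    qed
    then show "?S' \<subseteq> {1..m} \<and> f A - f ?S' \<le> exp (- min (card ?S') a / ((real d + 1) * a)) * f A"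
      using sub by blast
  qed (use a normalized in auto)
  then show ?thesis by (simp add: a_def)
qed

text \<open>The first budget is \<open>k\<close>, so \<open>A\<close> itself competes as a batch;
  later rounds only increase the value. The disjunct \<open>S = {}\<close> covers the initial
  state.\<close>

lemma single_round_optimal:
  assumes run: "batched_greedy m f k sel = Some (S, n)"
    and A: "A \<subseteq> {1..m}" "card A \<le> k" and d: "k \<le> d"
  shows "S = {} \<or> f A \<le> f S"
proof -
  have "S \<subseteq> {1..m} \<and> (S = {} \<or> f A \<le> f S)"
  proof (rule batched_greedy_invariant[OF run])
    fix S assume inv: "S \<subseteq> {1..m} \<and> (S = {} \<or> f A \<le> f S)"
    have sub: "S \<union> batch S \<subseteq> {1..m}" using inv batch_subset by blast
    then have "f S \<le> f (S \<union> batch S)" by (intro f_mono) auto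
    moreover have "f A \<le> f (batch {})"
      using batch_best[of A "{}"] A d by (simp add: marginal_def normalized)
    ultimately show "S \<union> batch S \<subseteq> {1..m} \<and> (S \<union> batch S = {} \<or> f A \<le> f (S \<union> batch S))"
      using inv sub by auto
  qed auto
  then show ?thesis by blast
qed

lemma guarantee:
  assumes run: "batched_greedy m f k sel = Some (S, n)" and k: "k > 0"
    and A: "A \<subseteq> {1..m}" "card A \<le> k"
  shows "(1 - exp (- 1 / (real d + 1))) * f A \<le> f S"
proof -
  have fA: "f A \<ge> 0" using f_mono[of "{}" A] A normalized by simp
  have weaken: ?thesis if "f A \<le> f S"
  proof -
    have "(1 - exp (- 1 / (real d + 1))) * f A \<le> 1 * f A"
      using fA by (intro mult_right_mono) auto
    then show ?thesis using that by simp
  qed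
  show ?thesis
  proof (cases "S = {1..m}")
    case True
    then show ?thesis using weaken f_mono[of A S] A by simp
  next
    case False
    then have card: "k \<le> card S" using stopped[OF run] by blast
    show ?thesis
    proof (cases "d < k")
      case True
      \<comment> \<open>The cap is reached on exit, so \<open>k - d\<close> cancels from the
        exponent.\<close>
      have "min (card S) (real k - d) = real k - d" using card by simp
      then have "f A - f S \<le> exp (- (real k - d) / ((real d + 1) * (real k - d))) * f A"
        using deficit[OF run A True] by simp
      also have "- (real k - d) / ((real d + 1) * (real k - d)) = - 1 / (real d + 1)"
        using True by (simp add: divide_simps)
      finally show ?thesis by (simp add: algebra_simps)
    next
      case False
      then show ?thesis
        using single_round_optimal[OF run A] weaken card k by auto
    qed
  qed
qed

lemma approx_solution_run:
  assumes run: "batched_greedy m f k sel = Some (S, n)" and k: "k > 0"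
  shows "approx_solution m f k (1 - exp (- 1 / (real d + 1))) S"
proof -
  let ?F = "{S'. S' \<subseteq> {1..m} \<and> card S' \<le> k}"
  have "finite ?F" by (rule finite_subset[of _ "Pow {1..m}"]) auto
  moreover have "{} \<in> ?F" by simp
  then have "?F \<noteq> {}" by blast
  ultimately have "Max (f ` ?F) \<in> f ` ?F"
    by (intro Max_in finite_imageI) (simp_all only: image_is_empty not_False_eq_True)
  then obtain A where "A \<subseteq> {1..m}" "card A \<le> k" "Max (f ` ?F) = f A" by auto
  then show ?thesis
    using guarantee[OF run k, of A] feasible[OF run] by (simp add: approx_solution_def)
qed

end

text \<open>\<open>C\<close> is chosen after \<open>k\<close> but before \<open>m\<close>,
  \<open>f\<close> and \<open>sel\<close>, so the hidden constant depends on \<open>k\<close>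
  alone.\<close>

theorem theorem8:
  fixes k :: nat
  assumes "k > 0"
  shows "\<exists>C::real. \<forall>(m::nat) (f::nat set \<Rightarrow> real) sel.
    f {} = 0 \<longrightarrow> mono_on (Pow {1..m}) f \<longrightarrow> selection_rule sel \<longrightarrow>
      (\<forall>S n. batched_greedy m f k sel = Some (S, n) \<longrightarrow>
         approx_solution m f k (1 - exp (- 1 / (real (SMW m f) + 1))) S \<and>
         real n \<le> C * real m ^ (SMW m f + 1)) \<and>
      (prefers_new sel \<longrightarrow> (\<exists>S n. batched_greedy m f k sel = Some (S, n)))"
\<comment> \<open>A terminating run has at most \<open>k\<close> rounds, each with at most
  \<open>(2 ^ k + 1) * m ^ (SMW m f + 1)\<close> queries.\<close>
proof (intro exI[of _ "real (k * (2 ^ k + 1))"] allI impI conjI)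
  fix m :: nat and f :: "nat set \<Rightarrow> real" and sel
  assume "f {} = 0" "mono_on (Pow {1..m}) f" "selection_rule sel"
  then interpret batched_greedy_run m k f sel by unfold_locales
  {
    fix S n assume run: "batched_greedy m f k sel = Some (S, n)"
    show "approx_solution m f k (1 - exp (- 1 / (real (SMW m f) + 1))) S"
      by (rule approx_solution_run[OF run assms])
    have "real n \<le> real (k * ((2 ^ k + 1) * m ^ (SMW m f + 1)))"
      using query_bound[OF run] by (rule of_nat_mono)
    then show "real n \<le> real (k * (2 ^ k + 1)) * real m ^ (SMW m f + 1)"
      by (simp add: algebra_simps)
  }
  assume "prefers_new sel"
  then show "\<exists>S n. batched_greedy m f k sel = Some (S, n)" by (rule terminates)
qed

end
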